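(* There are examples of taut contact spheres on open domains $U$ in $\mathbb{R}^3$ such that the induced hyperkähler metric $g$ on $U\times\mathbb{R}$ is not conformally flat.
   Context: A contact sphere on a $3$-manifold is a triple of $1$-forms $(\alpha_1,\alpha_2,\alpha_3)$ such that every non-trivial linear combination with constant coefficients is a contact form ($\alpha\wedge d\alpha$ nowhere zero). It is taut if $\lambda_1\alpha_1+\lambda_2\alpha_2+\lambda_3\alpha_3$ defines the same volume form $\alpha\wedge d\alpha$ for all $(\lambda_1,\lambda_2,\lambda_3)\in S^2$. It is naturally ordered if each $\alpha_i\wedge d\alpha_i$ is a positive multiple of $\alpha_1\wedge\alpha_2\wedge\alpha_3$; contact spheres are always assumed naturally ordered. For a naturally ordered taut contact sphere there are a unique $1$-form $\beta$ and a unique positive function $\Lambda$ with $d\alpha_i=\beta\wedge\alpha_i+\Lambda\,\alpha_j\wedge\alpha_k$ for all cyclic permutations $(i,j,k)$ of $(1,2,3)$. With $t$ the $\mathbb{R}$-coordinate on $U\times\mathbb{R}$, the induced hyperkähler structure $(g,J_1,J_2,J_3)$ on $U\times\mathbb{R}$ is determined by $-g(\cdot,J_i\,\cdot)=d(e^t\alpha_i)$, $i=1,2,3$; explicitly, $g=e^t\bigl(\Lambda^{-1}(dt+\beta)^2+\Lambda(\alpha_1^2+\alpha_2^2+\alpha_3^2)\bigr)$. *)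

theory Defs
  imports "HOL-Analysis.Analysis"
begin

section \<open>Smooth maps on open sets\<close>

text \<open>
  All notions below are meant for open domains, so derivatives are taken with respect to
  \<open>at x\<close>. The predicate \<open>C_k_on k f S\<close> says that all iterated directional derivatives
  of \<open>f\<close> of order less than \<open>k\<close> are (Frechet) differentiable on \<open>S\<close> and those of order \<open>k\<close>
  are continuous.
\<close>

primrec C_k_on ::
    "nat \<Rightarrow> ('a::real_normed_vector \<Rightarrow> 'b::real_normed_vector) \<Rightarrow> 'a set \<Rightarrow> bool" where
  "C_k_on 0 f S \<longleftrightarrow> continuous_on S f"
| "C_k_on (Suc k) f S \<longleftrightarrow>
     (\<forall>x\<in>S. f differentiable (at x)) \<and>
     (\<forall>v. C_k_on k (\<lambda>x. frechet_derivative f (at x) v) S)"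

definition smooth_on ::
    "'a::real_normed_vector set \<Rightarrow> ('a \<Rightarrow> 'b::real_normed_vector) \<Rightarrow> bool" where
  "smooth_on S f \<longleftrightarrow> (\<forall>k. C_k_on k f S)"

definition diffeomorphism ::
    "'a::real_normed_vector set \<Rightarrow> 'b::real_normed_vector set \<Rightarrow> ('a \<Rightarrow> 'b) \<Rightarrow> ('b \<Rightarrow> 'a) \<Rightarrow> bool" where
  "diffeomorphism S T f h \<longleftrightarrow>
     open S \<and> open T \<and> homeomorphism S T f h \<and> smooth_on S f \<and> smooth_on T h"


section \<open>Differential forms on open subsets of a vector space\<close>

text \<open>
  A \<open>p\<close>-form on an open set is given by its values on a point followed by \<open>p\<close> tangent vectors.
  The exterior derivatives below are the usual invariant formulas evaluated on constant vector
  fields, whose Lie brackets vanish. Wedge products are normalised by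
  \<open>(a \<and> b)(u, v) = a(u) b(v) - a(v) b(u)\<close> and, for a 1-form \<open>a\<close> and a 2-form \<open>w\<close>, by the
  cyclic sum \<open>(a \<and> w)(u, v, z) = a(u) w(v, z) + a(v) w(z, u) + a(z) w(u, v)\<close>.
\<close>

type_synonym 'a form1 = "'a \<Rightarrow> 'a \<Rightarrow> real"
type_synonym 'a form2 = "'a \<Rightarrow> 'a \<Rightarrow> 'a \<Rightarrow> real"
type_synonym 'a form3 = "'a \<Rightarrow> 'a \<Rightarrow> 'a \<Rightarrow> 'a \<Rightarrow> real"

definition one_form_on :: "'a::euclidean_space set \<Rightarrow> 'a form1 \<Rightarrow> bool" where
  "one_form_on S a \<longleftrightarrow> (\<forall>x\<in>S. linear (a x)) \<and> (\<forall>v. smooth_on S (\<lambda>x. a x v))"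

definition wedge11 :: "'a form1 \<Rightarrow> 'a form1 \<Rightarrow> 'a form2" where
  "wedge11 a b x u v = a x u * b x v - a x v * b x u"

definition wedge12 :: "'a form1 \<Rightarrow> 'a form2 \<Rightarrow> 'a form3" where
  "wedge12 a w x u v z = a x u * w x v z + a x v * w x z u + a x z * w x u v"

definition ext_deriv1 :: "'a::euclidean_space form1 \<Rightarrow> 'a form2" where
  "ext_deriv1 a x u v =
     frechet_derivative (\<lambda>y. a y v) (at x) u - frechet_derivative (\<lambda>y. a y u) (at x) v"

definition ext_deriv2 :: "'a::euclidean_space form2 \<Rightarrow> 'a form3" where
  "ext_deriv2 w x u v z =
     frechet_derivative (\<lambda>y. w y v z) (at x) u +
     frechet_derivative (\<lambda>y. w y z u) (at x) v +
     frechet_derivative (\<lambda>y. w y u v) (at x) z"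


section \<open>Contact spheres on domains in three-space\<close>

definition contact_volume :: "(real^3) form1 \<Rightarrow> (real^3) form3" where
  "contact_volume a = wedge12 a (ext_deriv1 a)"

definition contact_form_on :: "(real^3) set \<Rightarrow> (real^3) form1 \<Rightarrow> bool" where
  "contact_form_on U a \<longleftrightarrow>
     one_form_on U a \<and> (\<forall>x\<in>U. contact_volume a x \<noteq> (\<lambda>u v z. 0))"

text \<open>
  A triple of forms is indexed by the three-element type \<open>3\<close>; its elements are \<open>1\<close>, \<open>2\<close>
  and \<open>3\<close> with arithmetic modulo three, so that \<open>(i, i + 1, i + 2)\<close> runs through the
  cyclic permutations of \<open>(1, 2, 3)\<close>.
\<close>

definition lin_comb :: "real^3 \<Rightarrow> (3 \<Rightarrow> (real^3) form1) \<Rightarrow> (real^3) form1" where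
  "lin_comb c \<alpha> x v = (\<Sum>i\<in>UNIV. c $ i * \<alpha> i x v)"

definition contact_sphere_on :: "(real^3) set \<Rightarrow> (3 \<Rightarrow> (real^3) form1) \<Rightarrow> bool" where
  "contact_sphere_on U \<alpha> \<longleftrightarrow>
     (\<forall>i. one_form_on U (\<alpha> i)) \<and> (\<forall>c. c \<noteq> 0 \<longrightarrow> contact_form_on U (lin_comb c \<alpha>))"

definition taut_on :: "(real^3) set \<Rightarrow> (3 \<Rightarrow> (real^3) form1) \<Rightarrow> bool" where
  "taut_on U \<alpha> \<longleftrightarrow>
     (\<forall>c\<in>sphere 0 1. \<forall>c'\<in>sphere 0 1. \<forall>x\<in>U.
        contact_volume (lin_comb c \<alpha>) x = contact_volume (lin_comb c' \<alpha>) x)"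

definition naturally_ordered_on :: "(real^3) set \<Rightarrow> (3 \<Rightarrow> (real^3) form1) \<Rightarrow> bool" where
  "naturally_ordered_on U \<alpha> \<longleftrightarrow>
     (\<forall>i. \<forall>x\<in>U. \<exists>r>0. \<forall>u v z.
        contact_volume (\<alpha> i) x u v z = r * wedge12 (\<alpha> 1) (wedge11 (\<alpha> 2) (\<alpha> 3)) x u v z)"


section \<open>Hyperkaehler structures on open subsets of a vector space\<close>

type_synonym 'a metric_tensor = "'a \<Rightarrow> 'a \<Rightarrow> 'a \<Rightarrow> real"
type_synonym 'a endo_field = "'a \<Rightarrow> 'a \<Rightarrow> 'a"

definition riemannian_metric_on :: "'a::euclidean_space set \<Rightarrow> 'a metric_tensor \<Rightarrow> bool" where
  "riemannian_metric_on W g \<longleftrightarrow>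
     (\<forall>p\<in>W. bilinear (g p) \<and> (\<forall>u v. g p u v = g p v u) \<and> (\<forall>v. v \<noteq> 0 \<longrightarrow> g p v v > 0)) \<and>
     (\<forall>u v. smooth_on W (\<lambda>p. g p u v))"

definition lie_bracket ::
    "('a::euclidean_space \<Rightarrow> 'a) \<Rightarrow> ('a \<Rightarrow> 'a) \<Rightarrow> 'a \<Rightarrow> 'a" where
  "lie_bracket X Y p = frechet_derivative Y (at p) (X p) - frechet_derivative X (at p) (Y p)"

text \<open>
  The Nijenhuis tensor of \<open>J\<close>; being a tensor, it is determined by its values on constant
  vector fields.
\<close>

definition nijenhuis :: "'a::euclidean_space endo_field \<Rightarrow> 'a \<Rightarrow> 'a \<Rightarrow> 'a \<Rightarrow> 'a" where
  "nijenhuis J p u v =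
     lie_bracket (\<lambda>q. J q u) (\<lambda>q. J q v) p
     - J p (lie_bracket (\<lambda>q. J q u) (\<lambda>q. v) p)
     - J p (lie_bracket (\<lambda>q. u) (\<lambda>q. J q v) p)
     - lie_bracket (\<lambda>q. u) (\<lambda>q. v) p"

definition complex_structure_on :: "'a::euclidean_space set \<Rightarrow> 'a endo_field \<Rightarrow> bool" where
  "complex_structure_on W J \<longleftrightarrow>
     (\<forall>p\<in>W. linear (J p) \<and> (\<forall>v. J p (J p v) = - v)) \<and>
     (\<forall>v. smooth_on W (\<lambda>p. J p v)) \<and>
     (\<forall>p\<in>W. \<forall>u v. nijenhuis J p u v = 0)"

text \<open>The sign convention for the fundamental form is \<open>-g(\<cdot>, J \<cdot>) = g(J \<cdot>, \<cdot>)\<close>.\<close>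

definition fundamental_form :: "'a::euclidean_space metric_tensor \<Rightarrow> 'a endo_field \<Rightarrow> 'a form2" where
  "fundamental_form g J p u v = - g p u (J p v)"

definition kaehler_on ::
    "'a::euclidean_space set \<Rightarrow> 'a metric_tensor \<Rightarrow> 'a endo_field \<Rightarrow> bool" where
  "kaehler_on W g J \<longleftrightarrow>
     riemannian_metric_on W g \<and> complex_structure_on W J \<and>
     (\<forall>p\<in>W. \<forall>u v. g p (J p u) (J p v) = g p u v) \<and>
     (\<forall>p\<in>W. \<forall>u v z. ext_deriv2 (fundamental_form g J) p u v z = 0)"

definition hyperkaehler_on ::
    "'a::euclidean_space set \<Rightarrow> 'a metric_tensor \<Rightarrow> (3 \<Rightarrow> 'a endo_field) \<Rightarrow> bool" where
  "hyperkaehler_on W g J \<longleftrightarrow>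
     (\<forall>i. kaehler_on W g (J i)) \<and>
     (\<forall>i. \<forall>p\<in>W. \<forall>v. J i p (J (i + 1) p v) = J (i + 2) p v)"

text \<open>
  The form \<open>e\<^sup>t a\<close> on \<open>U \<times> \<real>\<close>, with \<open>a\<close> pulled back along the projection to \<open>U\<close>.
\<close>

definition exp_form :: "(real^3) form1 \<Rightarrow> ((real^3) \<times> real) form1" where
  "exp_form a p v = exp (snd p) * a (fst p) (fst v)"

definition induced_hyperkaehler ::
    "(real^3) set \<Rightarrow> (3 \<Rightarrow> (real^3) form1) \<Rightarrow>
     ((real^3) \<times> real) metric_tensor \<Rightarrow> (3 \<Rightarrow> ((real^3) \<times> real) endo_field) \<Rightarrow> bool" where
  "induced_hyperkaehler U \<alpha> g J \<longleftrightarrow>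
     hyperkaehler_on (U \<times> UNIV) g J \<and>
     (\<forall>i. \<forall>p\<in>U \<times> UNIV. \<forall>u v.
        fundamental_form g (J i) p u v = ext_deriv1 (exp_form (\<alpha> i)) p u v)"

text \<open>
  The forms \<open>d(e\<^sup>t \<alpha>\<^sub>i)\<close> determine \<open>g\<close> and the \<open>J\<^sub>i\<close>, so one may speak of the induced
  hyperkaehler structure.
\<close>

lemma induced_hyperkaehler_unique:
  assumes H: "induced_hyperkaehler U \<alpha> g J" and H': "induced_hyperkaehler U \<alpha> g' J'"
    and p: "p \<in> U \<times> UNIV"
  shows "J i p = J' i p" and "g p = g' p"
proof -
  have fund: "g p u (J k p v) = g' p u (J' k p v)" for k u v
  proof -
    have "- g p u (J k p v) = - g' p u (J' k p v)"
      using H H' p unfolding induced_hyperkaehler_def fundamental_form_def by metis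
    then show ?thesis by simp
  qed
  have hk: "hyperkaehler_on (U \<times> UNIV) g J" "hyperkaehler_on (U \<times> UNIV) g' J'"
    using H H' by (simp_all add: induced_hyperkaehler_def)
  have sq: "K k p (K k p v) = - v"
    if "hyperkaehler_on (U \<times> UNIV) G K" for G K k v
    using that p unfolding hyperkaehler_on_def kaehler_on_def complex_structure_on_def by blast
  note sq = sq[OF hk(1)] sq[OF hk(2)]
  have quat: "K k p (K (k + 1) p v) = K (k + 2) p v"
    if "hyperkaehler_on (U \<times> UNIV) G K" for G K k v
    using that p unfolding hyperkaehler_on_def by blast
  note quat = quat[OF hk(1)] quat[OF hk(2)]
  have "riemannian_metric_on (U \<times> UNIV) g"
    using hk(1) unfolding hyperkaehler_on_def kaehler_on_def by blast
  then have metric: "bilinear (g p) \<and> (\<forall>v. v \<noteq> 0 \<longrightarrow> g p v v > 0)"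
    using p unfolding riemannian_metric_on_def by blast
  have nondeg: "a = b" if "\<And>u. g p u a = g p u b" for a b
  proof (rule ccontr)
    assume "a \<noteq> b"
    then have "g p (a - b) (a - b) > 0" using metric right_minus_eq by blast
    then show False using that by (simp add: bilinear_rsub[OF conjunct1[OF metric]])
  qed
  have nondeg_J: "a = b" if "\<And>u. g p u (J k p a) = g p u (J k p b)" for a b k
  proof -
    have "J k p (J k p a) = J k p (J k p b)" using nondeg[OF that] by simp
    then show ?thesis by (simp only: sq neg_equal_iff_equal)
  qed
  have eq: "J (k + 1) p v = J' (k + 1) p v" for k v
  proof (rule nondeg_J[of k])
    fix u
    show "g p u (J k p (J (k + 1) p v)) = g p u (J k p (J' (k + 1) p v))"
      by (simp only: fund quat)
  qed
  have J_eq: "J k p v = J' k p v" for k v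
    using eq[of "k - 1" v] by (simp only: diff_add_cancel)
  show "J i p = J' i p" using J_eq by blast
  show "g p = g' p"
  proof (intro ext)
    fix u v
    show "g p u v = g' p u v"
      using fund[of u 1 "J 1 p (- v)"] by (simp only: J_eq[symmetric] sq minus_minus)
  qed
qed


section \<open>Conformal flatness\<close>

text \<open>
  A metric is conformally flat if near every point there is a chart in which it is a positive
  multiple of the Euclidean metric.
\<close>

definition conformally_flat_on :: "'a::euclidean_space set \<Rightarrow> 'a metric_tensor \<Rightarrow> bool" where
  "conformally_flat_on W g \<longleftrightarrow>
     (\<forall>p\<in>W. \<exists>V \<phi> \<psi> f.
        p \<in> V \<and> V \<subseteq> W \<and> diffeomorphism V (\<phi> ` V) \<phi> (\<psi> :: 'a \<Rightarrow> 'a) \<and>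
        smooth_on V f \<and> (\<forall>q\<in>V. f q > 0) \<and>
        (\<forall>q\<in>V. \<forall>u v. g q u v =
           f q * (frechet_derivative \<phi> (at q) u \<bullet> frechet_derivative \<phi> (at q) v)))"

end

theory Submission
  imports Defs
begin

text \<open>
  The Gibbons--Hawking metric \<open>V\<^sup>-\<^sup>1 (d\<theta> + A)\<^sup>2 + V (dx\<^sup>2 + dy\<^sup>2 + dz\<^sup>2)\<close> with the
  homogeneous harmonic potential \<open>V = z\<close> and \<open>dA = - dx \<and> dy\<close> is hyperkaehler, and the vector field
  \<open>X = (x \<partial>\<^sub>x + y \<partial>\<^sub>y + z \<partial>\<^sub>z + 2 \<theta> \<partial>\<^sub>\<theta>) / 3\<close> satisfies \<open>L\<^sub>X \<omega>\<^sub>i = \<omega>\<^sub>i\<close> for its three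
  Kaehler forms. Restricting the contractions of \<open>X\<close> with the \<open>\<omega>\<^sub>i\<close> to the slice \<open>z = 1\<close>, which is
  transverse to \<open>X\<close>, gives a taut contact sphere on \<open>\<real>\<^sup>3\<close>, and following the flow of \<open>X\<close> from
  this slice identifies the induced structure with the Gibbons--Hawking one.

  A conformally flat metric satisfies \<open>R(e\<^sub>1, e\<^sub>2, e\<^sub>3, e\<^sub>4) = 0\<close> for mutually orthogonal vectors,
  since on these the conformal factor only rescales the curvature. For the metric above this
  component is nonzero at a point.
\<close>

section \<open>Calculus of smooth functions\<close>

lemma frechet_derivative_eq:
  "(f has_derivative f') (at x) \<Longrightarrow> frechet_derivative f (at x) = f'"
  using frechet_derivative_at by metis

text \<open>On an open set a derivative only sees nearby values, so agreement on \<open>S\<close>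
  passes to all iterated derivatives.\<close>

lemma C_k_on_cong:
  assumes "open S" "C_k_on k f S" "\<And>x. x \<in> S \<Longrightarrow> f x = g x"
  shows "C_k_on k g S"
  using assms(2,3)
proof (induction k arbitrary: f g)
  case 0
  then show ?case
    by (simp cong: continuous_on_cong)
next
  case (Suc k)
  have deriv: "frechet_derivative f (at x) = frechet_derivative g (at x)" if "x \<in> S" for x
    using frechet_derivative_transform_within_open[OF _ assms(1) that] Suc.prems that by auto
  have "g differentiable (at x)" if "x \<in> S" for x
  proof -
    have "(f has_derivative frechet_derivative f (at x)) (at x)"
      using Suc.prems(1) that by (simp add: frechet_derivative_works)
    then show ?thesis
      using has_derivative_transform_within_open[OF _ assms(1) that] Suc.prems(2)
      unfolding differentiable_def by metis
  qed
  moreover have "C_k_on k (\<lambda>x. frechet_derivative g (at x) v) S" for v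
    using Suc.IH[of "\<lambda>x. frechet_derivative f (at x) v"] Suc.prems(1) deriv by simp
  ultimately show ?case by simp
qed

lemma C_k_on_SucD:
  "C_k_on (Suc k) f S \<Longrightarrow> C_k_on k f S"
proof (induction k arbitrary: f)
  case 0
  then show ?case
    by (simp add: continuous_at_imp_continuous_on differentiable_imp_continuous_within)
next
  case (Suc k)
  then show ?case by (metis C_k_on.simps(2))
qed

lemma C_k_on_imp_differentiable: "C_k_on k f S \<Longrightarrow> k > 0 \<Longrightarrow> x \<in> S \<Longrightarrow> f differentiable (at x)"
  by (cases k) auto

lemma C_k_on_subset: "C_k_on k f S \<Longrightarrow> T \<subseteq> S \<Longrightarrow> C_k_on k f T"
  by (induction k arbitrary: f) (auto intro: continuous_on_subset)

lemma C_k_on_const: "C_k_on k (\<lambda>x. c) S"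
  by (induction k arbitrary: c) (simp_all add: frechet_derivative_const)

lemma C_k_on_bounded_linear:
  assumes "bounded_linear f"
  shows "C_k_on k f S"
proof (cases k)
  case 0
  then show ?thesis using assms by (simp add: linear_continuous_on)
next
  case (Suc m)
  have "frechet_derivative f (at x) = f" for x
    using bounded_linear_imp_has_derivative[OF assms] by (simp add: frechet_derivative_eq)
  then show ?thesis
    using Suc bounded_linear_imp_differentiable[OF assms] by (simp add: C_k_on_const)
qed

lemma C_k_on_add:
  assumes "open S" "C_k_on k f S" "C_k_on k g S"
  shows "C_k_on k (\<lambda>x. f x + g x) S"
  using assms(2,3)
proof (induction k arbitrary: f g)
  case 0
  then show ?case by (simp add: continuous_on_add)
next
  case (Suc k)
  have der: "((\<lambda>x. f x + g x) has_derivative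
      (\<lambda>v. frechet_derivative f (at x) v + frechet_derivative g (at x) v)) (at x)"
    if "x \<in> S" for x
    using Suc.prems that by (intro has_derivative_add) (simp_all add: frechet_derivative_works[symmetric])
  have "C_k_on k (\<lambda>x. frechet_derivative (\<lambda>x. f x + g x) (at x) v) S" for v
  proof (rule C_k_on_cong[OF assms(1)])
    show "C_k_on k (\<lambda>x. frechet_derivative f (at x) v + frechet_derivative g (at x) v) S"
      using Suc by simp
  qed (simp add: frechet_derivative_eq[OF der])
  then show ?case using der by (auto simp: differentiable_def)
qed

text \<open>One induction by the Leibniz rule, for any bounded bilinear map, serves multiplication,
  scaling and inner products. Each factor also occurs undifferentiated, hence the drop in order
  through \<open>C_k_on_SucD\<close>.\<close>

lemma (in bounded_bilinear) C_k_on_prod: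
  assumes "open S" "C_k_on k f S" "C_k_on k g S"
  shows "C_k_on k (\<lambda>x. prod (f x) (g x)) S"
  using assms(2,3)
proof (induction k arbitrary: f g)
  case 0
  then show ?case by (simp add: continuous_on)
next
  case (Suc k)
  have der: "((\<lambda>x. prod (f x) (g x)) has_derivative
      (\<lambda>v. prod (f x) (frechet_derivative g (at x) v) + prod (frechet_derivative f (at x) v) (g x))) (at x)"
    if "x \<in> S" for x
    using Suc.prems that by (intro FDERIV) (simp_all add: frechet_derivative_works[symmetric])
  have "C_k_on k (\<lambda>x. frechet_derivative (\<lambda>x. prod (f x) (g x)) (at x) v) S" for v
  proof (rule C_k_on_cong[OF assms(1)])
    show "C_k_on k (\<lambda>x. prod (f x) (frechet_derivative g (at x) v) + prod (frechet_derivative f (at x) v) (g x)) S"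
      using Suc.prems C_k_on_SucD[OF Suc.prems(1)] C_k_on_SucD[OF Suc.prems(2)]
      by (intro C_k_on_add Suc.IH assms(1)) simp_all
  qed (simp add: frechet_derivative_eq[OF der])
  then show ?case using der by (auto simp: differentiable_def)
qed

text \<open>The derivative contains \<open>exp (f x)\<close> itself, so the induction hypothesis
  supplies the first factor of the product.\<close>

lemma C_k_on_exp:
  fixes f :: "'a::real_normed_vector \<Rightarrow> real"
  assumes "open S" "C_k_on k f S"
  shows "C_k_on k (\<lambda>x. exp (f x)) S"
  using assms(2)
proof (induction k)
  case 0
  then show ?case by (simp add: continuous_on_exp)
next
  case (Suc k)
  have der: "((\<lambda>x. exp (f x)) has_derivative
      (\<lambda>v. exp (f x) * frechet_derivative f (at x) v)) (at x)" if "x \<in> S" for x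
  proof -
    have "(f has_derivative frechet_derivative f (at x)) (at x)"
      using Suc.prems that by (simp add: frechet_derivative_works)
    then show ?thesis by (auto intro!: derivative_eq_intros)
  qed
  have "C_k_on k (\<lambda>x. frechet_derivative (\<lambda>x. exp (f x)) (at x) v) S" for v
  proof (rule C_k_on_cong[OF assms(1)])
    show "C_k_on k (\<lambda>x. exp (f x) * frechet_derivative f (at x) v) S"
      using Suc C_k_on_SucD[OF Suc.prems]
      by (intro bounded_bilinear.C_k_on_prod[OF bounded_bilinear_mult] assms(1)) simp_all
  qed (simp add: frechet_derivative_eq[OF der])
  then show ?case using der by (auto simp: differentiable_def)
qed

section \<open>Closure rules for smooth functions\<close>

lemma smooth_on_const: "smooth_on S (\<lambda>x. c)"
  by (simp add: smooth_on_def C_k_on_const)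

lemma smooth_on_bounded_linear: "bounded_linear f \<Longrightarrow> smooth_on S f"
  by (simp add: smooth_on_def C_k_on_bounded_linear)

lemma smooth_on_add:
  "open S \<Longrightarrow> smooth_on S f \<Longrightarrow> smooth_on S g \<Longrightarrow> smooth_on S (\<lambda>x. f x + g x)"
  by (simp add: smooth_on_def C_k_on_add)

lemma smooth_on_scaleR:
  "open S \<Longrightarrow> smooth_on S f \<Longrightarrow> smooth_on S g \<Longrightarrow> smooth_on S (\<lambda>x. f x *\<^sub>R g x)"
  by (simp add: smooth_on_def bounded_bilinear.C_k_on_prod[OF bounded_bilinear_scaleR])

lemma smooth_on_mult:
  fixes f g :: "'a::real_normed_vector \<Rightarrow> real"
  shows "open S \<Longrightarrow> smooth_on S f \<Longrightarrow> smooth_on S g \<Longrightarrow> smooth_on S (\<lambda>x. f x * g x)"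
  using smooth_on_scaleR[of S f g] by simp

lemma smooth_on_diff:
  assumes "open S" "smooth_on S f" "smooth_on S g"
  shows "smooth_on S (\<lambda>x. f x - g x)"
  using smooth_on_add[OF assms(1,2) smooth_on_scaleR[OF assms(1) smooth_on_const assms(3)], of "-1"]
  by simp

lemma smooth_on_minus:
  assumes "open S" "smooth_on S f"
  shows "smooth_on S (\<lambda>x. - f x)"
  using smooth_on_diff[OF assms(1) smooth_on_const assms(2), of 0] by simp

lemma smooth_on_divide:
  fixes f :: "'a::real_normed_vector \<Rightarrow> real"
  assumes "open S" "smooth_on S f"
  shows "smooth_on S (\<lambda>x. f x / c)"
  using smooth_on_mult[OF assms smooth_on_const, of "1 / c"] by simp

lemma smooth_on_exp:
  fixes f :: "'a::real_normed_vector \<Rightarrow> real"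
  shows "open S \<Longrightarrow> smooth_on S f \<Longrightarrow> smooth_on S (\<lambda>x. exp (f x))"
  by (simp add: smooth_on_def C_k_on_exp)

lemmas smooth_on_intros =
  smooth_on_const smooth_on_add smooth_on_diff smooth_on_minus smooth_on_scaleR smooth_on_mult
  smooth_on_divide smooth_on_exp

section \<open>Symmetry of second derivatives\<close>

text \<open>The direction comes first, so that iterated derivatives nest as operators on
  functions.\<close>

abbreviation dirderiv ::
    "'a::real_normed_vector \<Rightarrow> ('a \<Rightarrow> 'b::real_normed_vector) \<Rightarrow> 'a \<Rightarrow> 'b" where
  "dirderiv v f \<equiv> \<lambda>x. frechet_derivative f (at x) v"

lemma C_k_on_dirderiv: "C_k_on (Suc k) f S \<Longrightarrow> C_k_on k (dirderiv v f) S"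
  by simp

lemma dirderiv_line:
  fixes f :: "'a::real_normed_vector \<Rightarrow> real"
  assumes "f differentiable (at (x + r *\<^sub>R v))"
  shows "((\<lambda>r. f (x + r *\<^sub>R v)) has_real_derivative dirderiv v f (x + r *\<^sub>R v)) (at r)"
proof -
  have f: "(f has_derivative frechet_derivative f (at (x + r *\<^sub>R v))) (at (x + r *\<^sub>R v))"
    using assms by (simp add: frechet_derivative_works)
  have "((\<lambda>r. f (x + r *\<^sub>R v)) has_derivative
      (\<lambda>h. frechet_derivative f (at (x + r *\<^sub>R v)) (h *\<^sub>R v))) (at r)"
    by (rule has_derivative_compose[where f = "\<lambda>r. x + r *\<^sub>R v" and g = f, OF _ f]) (auto intro!: derivative_eq_intros)
  then show ?thesis
    unfolding has_field_derivative_def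
    by (rule has_derivative_eq_rhs)
      (simp add: fun_eq_iff linear_scale[OF linear_frechet_derivative[OF assms]] mult.commute)
qed

text \<open>The mean value theorem, once along \<open>u\<close> and once along \<open>v\<close>,
  turns the second difference into a mixed derivative at a point inside the parallelogram.\<close>

lemma second_difference_mean_value:
  fixes f :: "'a::real_normed_vector \<Rightarrow> real"
  assumes "C_k_on 2 f S" "s > 0"
    and inS: "\<And>a b. 0 \<le> a \<Longrightarrow> a \<le> s \<Longrightarrow> 0 \<le> b \<Longrightarrow> b \<le> s \<Longrightarrow> x + a *\<^sub>R u + b *\<^sub>R v \<in> S"
  obtains a b where "0 < a" "a < s" "0 < b" "b < s"
    "f (x + s *\<^sub>R u + s *\<^sub>R v) - f (x + s *\<^sub>R u) - f (x + s *\<^sub>R v) + f x =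
       s\<^sup>2 * dirderiv v (dirderiv u f) (x + a *\<^sub>R u + b *\<^sub>R v)"
proof -
  have diff: "f differentiable (at y)" "dirderiv u f differentiable (at y)" if "y \<in> S" for y
    using assms(1) that by (auto simp: eval_nat_numeral)
  \<comment> \<open>The second difference is the increment along \<open>u\<close> of the difference
    between the two edges parallel to \<open>u\<close>.\<close>
  have "\<exists>a. 0 < a \<and> a < s \<and>
      (f (x + s *\<^sub>R v + s *\<^sub>R u) - f (x + s *\<^sub>R u)) - (f (x + s *\<^sub>R v + 0 *\<^sub>R u) - f (x + 0 *\<^sub>R u)) =
      (s - 0) * (dirderiv u f (x + s *\<^sub>R v + a *\<^sub>R u) - dirderiv u f (x + a *\<^sub>R u))"
  proof (rule MVT2[OF assms(2)])
    fix a assume a: "0 \<le> a" "a \<le> s"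
    have "x + s *\<^sub>R v + a *\<^sub>R u \<in> S" "x + a *\<^sub>R u \<in> S"
      using inS[OF a, of s] inS[OF a, of 0] assms(2) by (simp_all add: algebra_simps)
    then show "((\<lambda>a. f (x + s *\<^sub>R v + a *\<^sub>R u) - f (x + a *\<^sub>R u)) has_real_derivative
        dirderiv u f (x + s *\<^sub>R v + a *\<^sub>R u) - dirderiv u f (x + a *\<^sub>R u)) (at a)"
      by (intro DERIV_diff dirderiv_line diff)
  qed
  then obtain a where a: "0 < a" "a < s" and eq1:
      "(f (x + s *\<^sub>R v + s *\<^sub>R u) - f (x + s *\<^sub>R u)) - (f (x + s *\<^sub>R v) - f x) =
      s * (dirderiv u f (x + s *\<^sub>R v + a *\<^sub>R u) - dirderiv u f (x + a *\<^sub>R u))"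
    by auto
  have "\<exists>b. 0 < b \<and> b < s \<and>
      dirderiv u f (x + a *\<^sub>R u + s *\<^sub>R v) - dirderiv u f (x + a *\<^sub>R u + 0 *\<^sub>R v) =
      (s - 0) * dirderiv v (dirderiv u f) (x + a *\<^sub>R u + b *\<^sub>R v)"
    using a inS by (intro MVT2[OF assms(2)] dirderiv_line diff) auto
  then obtain b where b: "0 < b" "b < s" and eq2:
      "dirderiv u f (x + a *\<^sub>R u + s *\<^sub>R v) - dirderiv u f (x + a *\<^sub>R u) =
      s * dirderiv v (dirderiv u f) (x + a *\<^sub>R u + b *\<^sub>R v)"
    by auto
  have comm: "x + s *\<^sub>R v + a *\<^sub>R u = x + a *\<^sub>R u + s *\<^sub>R v" for a
    by simp
  show ?thesis
    using that[OF a b] eq1 unfolding comm eq2 by (simp add: power2_eq_square algebra_simps)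
qed

text \<open>The second difference is symmetric in \<open>u\<close> and \<open>v\<close>, and divided
  by the squared side length it is close to both mixed derivatives; continuity makes them
  coincide.\<close>

lemma dirderiv_commute_real:
  fixes f :: "'a::real_normed_vector \<Rightarrow> real"
  assumes "open S" "C_k_on 2 f S" "x \<in> S"
  shows "dirderiv v (dirderiv u f) x = dirderiv u (dirderiv v f) x"
proof (rule ccontr)
  assume neq: "dirderiv v (dirderiv u f) x \<noteq> dirderiv u (dirderiv v f) x"
  \<comment> \<open>Half of the gap: two equal numbers cannot lie within \<open>e\<close> of the two
    mixed derivatives respectively.\<close>
  define e where "e = \<bar>dirderiv v (dirderiv u f) x - dirderiv u (dirderiv v f) x\<bar> / 2"
  have "e > 0" using neq by (simp add: e_def)
  have cont: "continuous_on S (dirderiv b (dirderiv a f))" for a b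
    using assms(2) by (auto simp: eval_nat_numeral)
  have "\<exists>d>0. \<forall>y. dist y x < d \<longrightarrow> y \<in> S \<and>
      dist (dirderiv b (dirderiv a f) y) (dirderiv b (dirderiv a f) x) < e" for a b
  proof -
    have "continuous (at x) (dirderiv b (dirderiv a f))"
      using cont assms(1,3) by (simp add: continuous_on_eq_continuous_at)
    then obtain d1 where "d1 > 0" "\<forall>y. dist y x < d1 \<longrightarrow>
        dist (dirderiv b (dirderiv a f) y) (dirderiv b (dirderiv a f) x) < e"
      using \<open>e > 0\<close> unfolding continuous_at_eps_delta by blast
    moreover obtain d2 where "d2 > 0" "\<forall>y. dist y x < d2 \<longrightarrow> y \<in> S"
      using assms(1,3) unfolding open_dist by blast
    ultimately show ?thesis
      by (intro exI[of _ "min d1 d2"]) auto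
  qed
  note near = this
  obtain d where d: "d > 0" "\<And>y. dist y x < d \<Longrightarrow> y \<in> S"
      "\<And>y. dist y x < d \<Longrightarrow> \<bar>dirderiv v (dirderiv u f) y - dirderiv v (dirderiv u f) x\<bar> < e"
    using near[where a = u and b = v] by (auto simp: dist_real_def)
  obtain d' where d': "d' > 0"
      "\<And>y. dist y x < d' \<Longrightarrow> \<bar>dirderiv u (dirderiv v f) y - dirderiv u (dirderiv v f) x\<bar> < e"
    using near[where a = v and b = u] by (auto simp: dist_real_def)
  define N where "N = norm u + norm v + 1"
  \<comment> \<open>With this side length the parallelogram stays within half of
    \<open>min d d'\<close> of \<open>x\<close>, inside both neighbourhoods.\<close>
  define s where "s = min d d' / (2 * N)"
  have pos: "N > 0" by (simp add: N_def add_nonneg_pos)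
  then have "s > 0" using d d' unfolding s_def by (intro divide_pos_pos) auto
  have close: "dist (x + a *\<^sub>R u + b *\<^sub>R v) x < min d d'"
    if "0 \<le> a" "a \<le> s" "0 \<le> b" "b \<le> s" for a b
  proof -
    have "dist (x + a *\<^sub>R u + b *\<^sub>R v) x = norm (a *\<^sub>R u + b *\<^sub>R v)"
      by (simp add: dist_norm algebra_simps)
    also have "\<dots> \<le> a * norm u + b * norm v"
      using norm_triangle_ineq[of "a *\<^sub>R u" "b *\<^sub>R v"] that by simp
    also have "\<dots> \<le> s * norm u + s * norm v"
      using that by (intro add_mono mult_right_mono) auto
    also have "\<dots> \<le> s * N"
      using \<open>s > 0\<close> by (simp add: N_def algebra_simps)
    also have "\<dots> = min d d' / 2"
      using pos unfolding s_def by simp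
    also have "\<dots> < min d d'" using d(1) d'(1) by (simp add: min_def)
    finally show ?thesis .
  qed
  obtain a b where ab: "0 < a" "a < s" "0 < b" "b < s"
    "f (x + s *\<^sub>R u + s *\<^sub>R v) - f (x + s *\<^sub>R u) - f (x + s *\<^sub>R v) + f x =
       s\<^sup>2 * dirderiv v (dirderiv u f) (x + a *\<^sub>R u + b *\<^sub>R v)"
    using close d(2) by (rule_tac second_difference_mean_value[OF assms(2) \<open>s > 0\<close>]) auto
  \<comment> \<open>The same second difference again, with the roles of \<open>u\<close> and
    \<open>v\<close> exchanged.\<close>
  obtain b' a' where ab': "0 < b'" "b' < s" "0 < a'" "a' < s"
    "f (x + s *\<^sub>R v + s *\<^sub>R u) - f (x + s *\<^sub>R v) - f (x + s *\<^sub>R u) + f x =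
       s\<^sup>2 * dirderiv u (dirderiv v f) (x + b' *\<^sub>R v + a' *\<^sub>R u)"
  proof (rule second_difference_mean_value[OF assms(2) \<open>s > 0\<close>])
    show "x + b *\<^sub>R v + a *\<^sub>R u \<in> S" if "0 \<le> b" "b \<le> s" "0 \<le> a" "a \<le> s" for a b
      using close[OF that(3,4,1,2)] d(2)[of "x + b *\<^sub>R v + a *\<^sub>R u"] by (simp add: algebra_simps)
  qed blast
  have "s\<^sup>2 * dirderiv v (dirderiv u f) (x + a *\<^sub>R u + b *\<^sub>R v) =
      s\<^sup>2 * dirderiv u (dirderiv v f) (x + a' *\<^sub>R u + b' *\<^sub>R v)"
    using ab(5) ab'(5) by (simp add: algebra_simps)
  then have "dirderiv v (dirderiv u f) (x + a *\<^sub>R u + b *\<^sub>R v) =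
      dirderiv u (dirderiv v f) (x + a' *\<^sub>R u + b' *\<^sub>R v)"
    using \<open>s > 0\<close> by simp
  moreover have "\<bar>dirderiv v (dirderiv u f) (x + a *\<^sub>R u + b *\<^sub>R v) - dirderiv v (dirderiv u f) x\<bar> < e"
    using close[of a b] ab by (intro d(3)) auto
  moreover have "\<bar>dirderiv u (dirderiv v f) (x + a' *\<^sub>R u + b' *\<^sub>R v) - dirderiv u (dirderiv v f) x\<bar> < e"
    using close[of a' b'] ab' by (intro d'(2)) auto
  ultimately show False unfolding e_def by (smt (verit) field_sum_of_halves)
qed

lemma dirderiv_inner_const:
  fixes f :: "'a::real_normed_vector \<Rightarrow> 'b::real_inner"
  assumes "f differentiable (at x)"
  shows "dirderiv v (\<lambda>x. f x \<bullet> b) x = dirderiv v f x \<bullet> b"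
proof -
  have "(f has_derivative frechet_derivative f (at x)) (at x)"
    using assms by (simp add: frechet_derivative_works)
  then have "((\<lambda>x. f x \<bullet> b) has_derivative (\<lambda>v. frechet_derivative f (at x) v \<bullet> b)) (at x)"
    by (auto intro!: derivative_eq_intros)
  then show ?thesis by (simp add: frechet_derivative_eq)
qed

text \<open>A vector is determined by its inner products, so the real case applied to
  \<open>f x \<bullet> b\<close> suffices.\<close>

lemma dirderiv_commute:
  fixes f :: "'a::real_normed_vector \<Rightarrow> 'b::real_inner"
  assumes "open S" "C_k_on 2 f S" "x \<in> S"
  shows "dirderiv v (dirderiv u f) x = dirderiv u (dirderiv v f) x"
proof -
  have "dirderiv v (dirderiv u f) x \<bullet> b = dirderiv u (dirderiv v f) x \<bullet> b" for b
  proof -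
    have diff: "f differentiable (at y)" "dirderiv w f differentiable (at y)" if "y \<in> S" for y w
      using assms(2) that by (auto simp: eval_nat_numeral)
    have second: "dirderiv w' (dirderiv w f) x \<bullet> b = dirderiv w' (dirderiv w (\<lambda>x. f x \<bullet> b)) x"
      for w w'
    proof -
      have "dirderiv w' (dirderiv w f) x \<bullet> b = dirderiv w' (\<lambda>y. dirderiv w f y \<bullet> b) x"
        using diff assms(3) by (simp add: dirderiv_inner_const)
      also have "frechet_derivative (\<lambda>y. dirderiv w f y \<bullet> b) (at x) =
          frechet_derivative (dirderiv w (\<lambda>x. f x \<bullet> b)) (at x)"
        using diff assms(3)
        by (intro frechet_derivative_transform_within_open[OF _ assms(1,3)])
          (auto simp: dirderiv_inner_const intro: differentiable_inner)
      finally show ?thesis .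
    qed
    have "C_k_on 2 (\<lambda>x. f x \<bullet> b) S"
      using assms(1,2) by (intro bounded_bilinear.C_k_on_prod[OF bounded_bilinear_inner] C_k_on_const)
    then show ?thesis
      unfolding second by (rule dirderiv_commute_real[OF assms(1) _ assms(3)])
  qed
  then show ?thesis using vector_eq_rdot by blast
qed

section \<open>Product rules up to second order, and closedness of exact 2-forms\<close>

lemma dirderiv_cong:
  assumes "open S" "x \<in> S" "\<And>y. y \<in> S \<Longrightarrow> f y = g y" "f differentiable (at x)"
  shows "dirderiv v f x = dirderiv v g x"
  using frechet_derivative_transform_within_open[OF assms(4,1,2,3)] by simp

lemma dirderiv_inner:
  fixes f g :: "'a::real_normed_vector \<Rightarrow> 'b::real_inner"
  assumes "f differentiable (at x)" "g differentiable (at x)"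
  shows "dirderiv v (\<lambda>x. f x \<bullet> g x) x = f x \<bullet> dirderiv v g x + dirderiv v f x \<bullet> g x"
proof -
  have "((\<lambda>x. f x \<bullet> g x) has_derivative
      (\<lambda>v. f x \<bullet> frechet_derivative g (at x) v + frechet_derivative f (at x) v \<bullet> g x)) (at x)"
    using assms by (intro has_derivative_inner) (simp_all add: frechet_derivative_works[symmetric])
  then show ?thesis by (simp add: frechet_derivative_eq)
qed

lemma dirderiv_dirderiv_inner:
  fixes f g :: "'a::real_normed_vector \<Rightarrow> 'b::real_inner"
  assumes "open S" "x \<in> S" "C_k_on 2 f S" "C_k_on 2 g S"
  shows "dirderiv u (dirderiv v (\<lambda>x. f x \<bullet> g x)) x =
    f x \<bullet> dirderiv u (dirderiv v g) x + dirderiv u f x \<bullet> dirderiv v g x +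
    dirderiv v f x \<bullet> dirderiv u g x + dirderiv u (dirderiv v f) x \<bullet> g x"
proof -
  have diff: "f differentiable (at y)" "g differentiable (at y)"
      "dirderiv v f differentiable (at y)" "dirderiv v g differentiable (at y)" if "y \<in> S" for y
    using assms(3,4) that by (auto simp: eval_nat_numeral)
  have "dirderiv u (dirderiv v (\<lambda>x. f x \<bullet> g x)) x =
      dirderiv u (\<lambda>y. f y \<bullet> dirderiv v g y + dirderiv v f y \<bullet> g y) x"
    using diff assms(2)
    by (intro dirderiv_cong[OF assms(1,2), symmetric])
      (simp_all add: dirderiv_inner differentiable_inner)
  moreover have "((\<lambda>y. f y \<bullet> dirderiv v g y + dirderiv v f y \<bullet> g y) has_derivative
      (\<lambda>u. (f x \<bullet> dirderiv u (dirderiv v g) x + dirderiv u f x \<bullet> dirderiv v g x) +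
        (dirderiv v f x \<bullet> dirderiv u g x + dirderiv u (dirderiv v f) x \<bullet> g x))) (at x)"
    using diff assms(2)
    by (intro has_derivative_add has_derivative_inner)
      (simp_all add: frechet_derivative_works[symmetric])
  ultimately show ?thesis by (simp add: frechet_derivative_eq)
qed

lemma dirderiv_dirderiv_cong:
  assumes "open S" "x \<in> S" "C_k_on 2 f S" "\<And>y. y \<in> S \<Longrightarrow> f y = g y"
  shows "dirderiv u (dirderiv v f) x = dirderiv u (dirderiv v g) x"
  using assms(2-4)
  by (intro dirderiv_cong[OF assms(1,2)] dirderiv_cong[OF assms(1)]) (auto simp: eval_nat_numeral)

text \<open>In the cyclic sum the mixed second derivatives cancel in pairs by their
  symmetry.\<close>

lemma ext_deriv2_ext_deriv1:
  assumes "open S" "x \<in> S" "\<And>v. C_k_on 2 (\<lambda>y. a y v) S"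
  shows "ext_deriv2 (ext_deriv1 a) x u v z = 0"
proof -
  have "frechet_derivative (\<lambda>y. ext_deriv1 a y v z) (at x) u =
      dirderiv u (dirderiv v (\<lambda>y. a y z)) x - dirderiv u (dirderiv z (\<lambda>y. a y v)) x" for u v z
  proof -
    have "dirderiv w (\<lambda>y. a y w') differentiable (at x)" for w w'
      using assms(2,3) by (auto simp: eval_nat_numeral)
    then have "((\<lambda>y. ext_deriv1 a y v z) has_derivative
        (\<lambda>u. dirderiv u (dirderiv v (\<lambda>y. a y z)) x - dirderiv u (dirderiv z (\<lambda>y. a y v)) x)) (at x)"
      unfolding ext_deriv1_def by (auto intro!: has_derivative_diff simp: frechet_derivative_works[symmetric])
    then show ?thesis by (simp add: frechet_derivative_eq)
  qed
  then show ?thesis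
    unfolding ext_deriv2_def
    using dirderiv_commute[OF assms(1,3,2)] by simp
qed

section \<open>Gauss and Koszul identities for an immersion\<close>

text \<open>These are the Christoffel symbols of the first kind of the pulled-back metric. Of the
  six terms of the product rule, four cancel by symmetry of second derivatives.\<close>

lemma koszul_identity:
  fixes \<phi> :: "'a::real_normed_vector \<Rightarrow> 'b::real_inner"
  assumes "open S" "x \<in> S" "C_k_on 2 \<phi> S"
  shows "2 * (dirderiv a (dirderiv b \<phi>) x \<bullet> dirderiv c \<phi> x) =
    dirderiv a (\<lambda>y. dirderiv b \<phi> y \<bullet> dirderiv c \<phi> y) x +
    dirderiv b (\<lambda>y. dirderiv a \<phi> y \<bullet> dirderiv c \<phi> y) x -
    dirderiv c (\<lambda>y. dirderiv a \<phi> y \<bullet> dirderiv b \<phi> y) x"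
proof -
  have "dirderiv v \<phi> differentiable (at x)" for v
    using assms(2,3) by (auto simp: eval_nat_numeral)
  then show ?thesis
    using dirderiv_commute[OF assms(1,3,2)]
    by (simp add: dirderiv_inner) (simp add: inner_commute algebra_simps)
qed

text \<open>This encodes the flatness of the pulled-back metric: every product with a third
  derivative of \<phi> occurs twice with opposite signs, so only products of second derivatives
  remain.\<close>

lemma gauss_identity:
  fixes \<phi> :: "'a::real_normed_vector \<Rightarrow> 'b::real_inner"
  assumes "open S" "x \<in> S" "C_k_on 3 \<phi> S"
  shows "2 * (dirderiv a (dirderiv b \<phi>) x \<bullet> dirderiv c (dirderiv d \<phi>) x -
      dirderiv a (dirderiv c \<phi>) x \<bullet> dirderiv b (dirderiv d \<phi>) x) =
    dirderiv a (dirderiv c (\<lambda>y. dirderiv b \<phi> y \<bullet> dirderiv d \<phi> y)) x -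
    dirderiv c (dirderiv d (\<lambda>y. dirderiv a \<phi> y \<bullet> dirderiv b \<phi> y)) x -
    dirderiv a (dirderiv b (\<lambda>y. dirderiv c \<phi> y \<bullet> dirderiv d \<phi> y)) x +
    dirderiv b (dirderiv d (\<lambda>y. dirderiv a \<phi> y \<bullet> dirderiv c \<phi> y)) x"
proof -
  have C2: "C_k_on 2 \<phi> S" "C_k_on 2 (dirderiv v \<phi>) S" for v
    using assms(3) C_k_on_SucD[of 2 \<phi> S] by (auto simp: eval_nat_numeral)
  have second: "dirderiv u (dirderiv v \<phi>) y = dirderiv v (dirderiv u \<phi>) y" if "y \<in> S" for u v y
    using dirderiv_commute[OF assms(1) C2(1) that] .
  have outer: "dirderiv u (dirderiv v (dirderiv w \<phi>)) x = dirderiv v (dirderiv u (dirderiv w \<phi>)) x"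
    for u v w
    using dirderiv_commute[OF assms(1) C2(2) assms(2)] .
  \<comment> \<open>Swapping the two inner directions means differentiating an identity that holds
    on all of \<open>S\<close>, hence \<open>dirderiv_cong\<close>.\<close>
  have inner: "dirderiv u (dirderiv v (dirderiv w \<phi>)) x = dirderiv u (dirderiv w (dirderiv v \<phi>)) x"
    for u v w
    using C2(2) second assms(2)
    by (intro dirderiv_cong[OF assms(1,2)]) (auto simp: eval_nat_numeral)
  show ?thesis
    unfolding dirderiv_dirderiv_inner[OF assms(1,2) C2(2) C2(2)]
    using second[OF assms(2)] outer inner
    by (simp add: inner_commute algebra_simps)
qed

text \<open>Parseval's identity for an orthogonal basis of common squared length
  \<open>s\<close>.\<close>

lemma inner_orthogonal_family:
  fixes P :: "'i \<Rightarrow> 'a::euclidean_space"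
  assumes "finite I" "card I = DIM('a)" "s > 0"
    and orth: "\<And>i j. i \<in> I \<Longrightarrow> j \<in> I \<Longrightarrow> P i \<bullet> P j = (if i = j then s else 0)"
  shows "s * (x \<bullet> y) = (\<Sum>i\<in>I. (x \<bullet> P i) * (y \<bullet> P i))"
proof -
  have inj: "inj_on P I"
    using orth assms(3) by (intro inj_onI) (metis less_irrefl)
  have "pairwise orthogonal (P ` I)" "0 \<notin> P ` I"
    using orth assms(3) by (auto simp: pairwise_def orthogonal_def) (metis inner_zero_left less_irrefl)
  then have "independent (P ` I)"
    by (rule pairwise_orthogonal_independent)
  then have "span (P ` I) = UNIV"
    using card_ge_dim_independent[of "P ` I" UNIV] assms(2) card_image[OF inj] by auto
  \<comment> \<open>The error of the expansion of \<open>y\<close>. It is orthogonal to a spanning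
    set, hence to itself.\<close>
  define z where "z = s *\<^sub>R y - (\<Sum>i\<in>I. (y \<bullet> P i) *\<^sub>R P i)"
  have "z \<bullet> P j = 0" if "j \<in> I" for j
    using that assms(1) by (simp add: z_def inner_diff_left inner_sum_left orth if_distrib cong: if_cong)
  then have "orthogonal z w" if "w \<in> P ` I" for w
    using that by (auto simp: orthogonal_def)
  then have "orthogonal z z"
    using orthogonal_to_span[of z "P ` I" z] \<open>span (P ` I) = UNIV\<close> by auto
  then have "x \<bullet> z = 0" by (simp add: orthogonal_def)
  then show ?thesis
    by (simp add: z_def inner_diff_right inner_sum_right mult.commute)
qed

section \<open>The Gibbons--Hawking example\<close>

lemmas bounded_linear_fst_nth = bounded_linear_compose[OF bounded_linear_vec_nth bounded_linear_fst]

text \<open>The contraction of \<open>X\<close> with (d\<theta> + A) \<and> dx + z dy \<and> dz and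
  its cyclic analogues, restricted to z = 1, where (x, y, \<theta>) are the coordinates of the
  point. There \<open>e\<close> is d\<theta> + A.\<close>

definition heis_form :: "3 \<Rightarrow> (real^3) form1" where
  "heis_form i x v =
    (let e = v $ 3 + (x $ 2 * v $ 1 - x $ 1 * v $ 2) / 2 in
     if i = 1 then (2 * x $ 3 * v $ 1 - x $ 1 * e - v $ 2) / 3
     else if i = 2 then (2 * x $ 3 * v $ 2 - x $ 2 * e + v $ 1) / 3
     else (x $ 1 * v $ 2 - x $ 2 * v $ 1 - e) / 3)"

text \<open>The base point moves in direction \<open>w\<close> while the argument \<open>v\<close>
  is fixed. The last case is short because \<open>x $ 1 * v $ 2 - x $ 2 * v $ 1\<close> has
  derivative \<open>- 2 * e'\<close>.\<close>

definition heis_form_deriv :: "3 \<Rightarrow> real^3 \<Rightarrow> real^3 \<Rightarrow> real^3 \<Rightarrow> real" where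
  "heis_form_deriv i x v w =
    (let e = v $ 3 + (x $ 2 * v $ 1 - x $ 1 * v $ 2) / 2; e' = (w $ 2 * v $ 1 - w $ 1 * v $ 2) / 2 in
     if i = 1 then (2 * w $ 3 * v $ 1 - w $ 1 * e - x $ 1 * e') / 3
     else if i = 2 then (2 * w $ 3 * v $ 2 - w $ 2 * e - x $ 2 * e') / 3
     else - e')"

lemma heis_form_has_derivative:
  "((\<lambda>x. heis_form i x v) has_derivative heis_form_deriv i x v) (at x)"
  unfolding heis_form_def heis_form_deriv_def Let_def
  by (cases "i = 1"; cases "i = 2")
    (auto intro!: derivative_eq_intros bounded_linear_imp_has_derivative[OF bounded_linear_vec_nth]
      simp: fun_eq_iff field_simps)

lemma one_form_heis_form: "one_form_on UNIV (heis_form i)"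
proof -
  have "linear (heis_form i x)" for x
    by (rule linearI) (simp_all add: heis_form_def Let_def field_simps)
  moreover have "smooth_on UNIV (\<lambda>x. heis_form i x v)" for v
    unfolding heis_form_def Let_def
    by (cases "i = 1"; cases "i = 2")
      (simp_all, (intro smooth_on_intros open_UNIV smooth_on_bounded_linear[OF bounded_linear_vec_nth])+)
  ultimately show ?thesis by (simp add: one_form_on_def)
qed

lemma one_form_lin_comb:
  assumes "open S" "\<And>i. one_form_on S (\<alpha> i)"
  shows "one_form_on S (lin_comb c \<alpha>)"
  unfolding one_form_on_def lin_comb_def sum_3
  using assms
  by (auto simp: one_form_on_def linear_iff algebra_simps intro!: smooth_on_intros)

definition det3 :: "(real^3) \<Rightarrow> (real^3) \<Rightarrow> (real^3) \<Rightarrow> real" where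
  "det3 u v z = u $ 1 * (v $ 2 * z $ 3 - v $ 3 * z $ 2) + u $ 2 * (v $ 3 * z $ 1 - v $ 1 * z $ 3) +
     u $ 3 * (v $ 1 * z $ 2 - v $ 2 * z $ 1)"

text \<open>The volume is a quadratic form in \<open>c\<close> with coefficients \<alpha>_i \<and>
  d\<alpha>_j. The diagonal entries agree and the others are antisymmetric, so only the norm of
  \<open>c\<close> matters; this gives both the contact condition and tautness.\<close>

lemma contact_volume_heis:
  "contact_volume (lin_comb c heis_form) x u v z = - (c \<bullet> c) / 3 * det3 u v z"
proof -
  have der: "((\<lambda>x. lin_comb c heis_form x v) has_derivative
      (\<lambda>w. \<Sum>i\<in>UNIV. c $ i * heis_form_deriv i x v w)) (at x)" for v
    unfolding lin_comb_def
    by (intro has_derivative_sum has_derivative_mult_right heis_form_has_derivative)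
  have ext: "ext_deriv1 (lin_comb c heis_form) x u v =
      (\<Sum>i\<in>UNIV. c $ i * heis_form_deriv i x v u) - (\<Sum>i\<in>UNIV. c $ i * heis_form_deriv i x u v)" for u v
    by (simp add: ext_deriv1_def frechet_derivative_eq[OF der])
  \<comment> \<open>\<open>B j\<close> is the exterior derivative of \<open>heis_form j\<close>, and
    \<open>V i j\<close> is its wedge product with \<open>heis_form i\<close>, evaluated on
    \<open>u\<close>, \<open>v\<close>, \<open>z\<close>.\<close>
  define B where "B j u v = heis_form_deriv j x v u - heis_form_deriv j x u v" for j u v
  define V where "V i j = heis_form i x u * B j v z + heis_form i x v * B j z u + heis_form i x z * B j u v"
    for i j
  note defs = V_def B_def heis_form_def heis_form_deriv_def det3_def Let_def
  have diag: "V 1 1 = - det3 u v z / 3" "V 2 2 = - det3 u v z / 3" "V 3 3 = - det3 u v z / 3"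
    unfolding defs by (simp_all add: field_simps)
  have offdiag: "V 2 1 = - V 1 2" "V 3 1 = - V 1 3" "V 3 2 = - V 2 3"
    unfolding defs by (simp_all add: field_simps)
  have "contact_volume (lin_comb c heis_form) x u v z = (\<Sum>i\<in>UNIV. \<Sum>j\<in>UNIV. c $ i * c $ j * V i j)"
    unfolding contact_volume_def wedge12_def ext lin_comb_def V_def B_def sum_3
    by (simp add: algebra_simps)
  also have "\<dots> = - (c \<bullet> c) / 3 * det3 u v z"
    by (simp add: sum_3 diag offdiag inner_vec_def field_simps)
  finally show ?thesis .
qed

lemma contact_volume_heis_form:
  "contact_volume (heis_form i) x u v z = - det3 u v z / 3"
proof -
  have "lin_comb (axis i 1) heis_form = heis_form i"
    using exhaust_3[of i] by (auto simp: fun_eq_iff lin_comb_def sum_3 axis_def)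
  then show ?thesis
    using contact_volume_heis[of "axis i 1" x u v z] by (simp add: inner_axis_axis)
qed

lemma contact_sphere_heis: "contact_sphere_on UNIV heis_form"
proof -
  have "contact_volume (lin_comb c heis_form) x \<noteq> (\<lambda>u v z. 0)" if "c \<noteq> 0" for c x
  proof
    assume "contact_volume (lin_comb c heis_form) x = (\<lambda>u v z. 0)"
    then have "contact_volume (lin_comb c heis_form) x (axis 1 1) (axis 2 1) (axis 3 1) = 0"
      by simp
    then show False
      using that by (simp add: contact_volume_heis det3_def axis_def)
  qed
  then show ?thesis
    by (simp add: contact_sphere_on_def contact_form_on_def one_form_heis_form one_form_lin_comb)
qed

lemma taut_heis: "taut_on UNIV heis_form"
  by (auto simp: taut_on_def fun_eq_iff contact_volume_heis dot_square_norm)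

lemma naturally_ordered_heis: "naturally_ordered_on UNIV heis_form"
  unfolding naturally_ordered_on_def
proof (intro allI ballI)
  fix i and x :: "real^3"
  \<comment> \<open>\<open>N / 9\<close> is \<open>heis_metric\<close> on the unit vector in the
    t-direction, up to the factor e^t. The ratio \<open>9 / N\<close> below is therefore
    \<Lambda>.\<close>
  define N where "N = 1 + (x $ 1)\<^sup>2 + (x $ 2)\<^sup>2 + 4 * (x $ 3)\<^sup>2"
  have "N > 0"
    unfolding N_def by (intro add_pos_nonneg) auto
  have "wedge12 (heis_form 1) (wedge11 (heis_form 2) (heis_form 3)) x u v z = - N / 27 * det3 u v z"
    for u v z
    by (simp add: wedge12_def wedge11_def heis_form_def Let_def det3_def N_def power2_eq_square
        field_simps)
  then show "\<exists>r>0. \<forall>u v z. contact_volume (heis_form i) x u v z =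
      r * wedge12 (heis_form 1) (wedge11 (heis_form 2) (heis_form 3)) x u v z"
    using \<open>N > 0\<close> by (intro exI[of _ "9 / N"]) (simp add: contact_volume_heis_form)
qed

section \<open>Adapted coframe and dual frame\<close>

text \<open>
  The point \<open>((u, v, w), t)\<close> has Gibbons--Hawking coordinates
  \<open>(x, y, z, \<theta>) = (r u, r v, r, r\<^sup>2 w)\<close> with \<open>r = e\<^bsup>t/3\<^esup>\<close>, and \<open>A = (y dx - x dy) / 2\<close>. Then \<open>cof1\<close>,
  \<open>cof2\<close>, \<open>cof3\<close>, \<open>cof4\<close> are \<open>dx / r\<close>, \<open>dy / r\<close>, \<open>(d\<theta> + A) / r\<^sup>2\<close>, \<open>dz / r\<close>.
\<close>

definition cof1 :: "((real^3) \<times> real) form1" where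
  "cof1 p v = fst v $ 1 + fst p $ 1 * snd v / 3"

definition cof2 :: "((real^3) \<times> real) form1" where
  "cof2 p v = fst v $ 2 + fst p $ 2 * snd v / 3"

definition cof3 :: "((real^3) \<times> real) form1" where
  "cof3 p v = fst v $ 3 + 2 * fst p $ 3 * snd v / 3 + (fst p $ 2 * fst v $ 1 - fst p $ 1 * fst v $ 2) / 2"

definition cof4 :: "((real^3) \<times> real) form1" where
  "cof4 p v = snd v / 3"

lemmas cof_defs = cof1_def cof2_def cof3_def cof4_def

text \<open>The frame dual to the coframe: the vector with prescribed values \<open>a\<close>,
  \<open>b\<close>, \<open>c\<close>, \<open>d\<close>, found by solving a triangular system
  starting from \<open>d\<close>.\<close>

definition heis_frame :: "(real^3) \<times> real \<Rightarrow> real \<Rightarrow> real \<Rightarrow> real \<Rightarrow> real \<Rightarrow> (real^3) \<times> real" where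
  "heis_frame p a b c d =
    ((a - fst p $ 1 * d) *\<^sub>R axis 1 1 + (b - fst p $ 2 * d) *\<^sub>R axis 2 1 +
     (c - 2 * fst p $ 3 * d - (fst p $ 2 * a - fst p $ 1 * b) / 2) *\<^sub>R axis 3 1, 3 * d)"

lemma cof_heis_frame [simp]:
  "cof1 p (heis_frame p a b c d) = a" "cof2 p (heis_frame p a b c d) = b"
  "cof3 p (heis_frame p a b c d) = c" "cof4 p (heis_frame p a b c d) = d"
  by (simp_all add: cof_defs heis_frame_def axis_def field_simps)

lemma heis_frame_cof: "heis_frame p (cof1 p v) (cof2 p v) (cof3 p v) (cof4 p v) = v"
proof (rule prod_eqI)
  show "fst (heis_frame p (cof1 p v) (cof2 p v) (cof3 p v) (cof4 p v)) = fst v"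
    unfolding vec_eq_iff forall_3 by (simp add: cof_defs heis_frame_def axis_def, simp add: algebra_simps)
qed (simp add: cof_defs heis_frame_def)

lemma cof_eqI:
  assumes "cof1 p u = cof1 p v" "cof2 p u = cof2 p v" "cof3 p u = cof3 p v" "cof4 p u = cof4 p v"
  shows "u = v"
  using heis_frame_cof assms by metis

lemma cof_linear: "linear (cof1 p)" "linear (cof2 p)" "linear (cof3 p)" "linear (cof4 p)"
  by (rule linearI; simp add: cof_defs field_simps)+

lemmas cof_simps =
  cof_linear[THEN linear_add] cof_linear[THEN linear_scale] cof_linear[THEN linear_neg]
  cof_linear[THEN linear_diff] cof_linear[THEN linear_0]

lemma heis_frame_linear:
  assumes "linear a" "linear b" "linear c" "linear d"
  shows "linear (\<lambda>v. heis_frame p (a v) (b v) (c v) (d v))"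
  by (rule linearI; rule cof_eqI[of p])
    (simp_all add: cof_simps assms[THEN linear_add] assms[THEN linear_scale])

lemma smooth_on_fst_nth: "smooth_on UNIV (\<lambda>p. fst p $ i)"
  by (intro smooth_on_bounded_linear bounded_linear_fst_nth)

lemma smooth_on_snd: "smooth_on UNIV snd"
  by (intro smooth_on_bounded_linear bounded_linear_snd)

lemma smooth_on_cof:
  "smooth_on UNIV (\<lambda>p. cof1 p v)" "smooth_on UNIV (\<lambda>p. cof2 p v)"
  "smooth_on UNIV (\<lambda>p. cof3 p v)" "smooth_on UNIV (\<lambda>p. cof4 p v)"
  unfolding cof_defs by (intro smooth_on_intros smooth_on_fst_nth open_UNIV)+

lemma smooth_on_heis_frame:
  assumes "smooth_on UNIV a" "smooth_on UNIV b" "smooth_on UNIV c" "smooth_on UNIV d"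
  shows "smooth_on UNIV (\<lambda>p. heis_frame p (a p) (b p) (c p) (d p))"
proof -
  \<comment> \<open>Constant vectors with scalar coefficients put the frame in the reach of the
    smoothness rules.\<close>
  have "heis_frame p a b c d =
      (a - fst p $ 1 * d) *\<^sub>R (axis 1 1, 0) + (b - fst p $ 2 * d) *\<^sub>R (axis 2 1, 0) +
      (c - 2 * fst p $ 3 * d - (fst p $ 2 * a - fst p $ 1 * b) / 2) *\<^sub>R (axis 3 1, 0) + (3 * d) *\<^sub>R (0, 1)"
    for p a b c d
    by (simp add: heis_frame_def)
  then show ?thesis
    by (simp only:) (intro smooth_on_intros smooth_on_fst_nth open_UNIV assms)
qed

section \<open>The induced metric and its quaternionic structure\<close>

definition heis_metric :: "((real^3) \<times> real) metric_tensor" where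
  "heis_metric p u v = exp (snd p) *
     (cof1 p u * cof1 p v + cof2 p u * cof2 p v + cof3 p u * cof3 p v + cof4 p u * cof4 p v)"

text \<open>Each \<open>heis_J i\<close> is a signed permutation of the frame, read off from the
  i-th Kaehler form by the convention -g(., J .). Isometry, square and quaternion relations thus
  reduce to signs.\<close>

definition heis_J :: "3 \<Rightarrow> ((real^3) \<times> real) endo_field" where
  "heis_J i p v =
    (if i = 1 then heis_frame p (cof3 p v) (- cof4 p v) (- cof1 p v) (cof2 p v)
     else if i = 2 then heis_frame p (cof4 p v) (cof3 p v) (- cof2 p v) (- cof1 p v)
     else heis_frame p (- cof2 p v) (cof1 p v) (- cof4 p v) (cof3 p v))"

lemma riemannian_heis_metric: "riemannian_metric_on UNIV heis_metric"
proof -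
  have "bilinear (heis_metric p)" for p
    unfolding bilinear_def heis_metric_def
    by (intro conjI allI linearI) (simp_all add: cof_simps algebra_simps)
  moreover have "heis_metric p v v > 0" if "v \<noteq> 0" for p v
  proof -
    have "cof1 p v \<noteq> 0 \<or> cof2 p v \<noteq> 0 \<or> cof3 p v \<noteq> 0 \<or> cof4 p v \<noteq> 0"
      using that cof_eqI[of p v 0] by (auto simp: cof_simps)
    then have "cof1 p v * cof1 p v + cof2 p v * cof2 p v + cof3 p v * cof3 p v + cof4 p v * cof4 p v > 0"
      by (smt (verit) zero_le_square mult_eq_0_iff)
    then show ?thesis by (simp add: heis_metric_def)
  qed
  moreover have "smooth_on UNIV (\<lambda>p. heis_metric p u v)" for u v
    unfolding heis_metric_def by (intro smooth_on_intros smooth_on_cof smooth_on_snd open_UNIV)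
  ultimately show ?thesis
    by (auto simp: riemannian_metric_on_def heis_metric_def mult.commute)
qed

lemma heis_J_isometry: "heis_metric p (heis_J i p u) (heis_J i p v) = heis_metric p u v"
  by (simp add: heis_metric_def heis_J_def)

lemma heis_J_square: "heis_J i p (heis_J i p v) = - v"
  by (rule cof_eqI[of p]) (simp_all add: heis_J_def cof_simps)

lemma heis_J_quaternion: "heis_J i p (heis_J (i + 1) p v) = heis_J (i + 2) p v"
  using exhaust_3[of i] by (auto simp: heis_J_def)

lemma heis_fundamental_form:
  "fundamental_form heis_metric (heis_J i) = ext_deriv1 (exp_form (heis_form i))"
proof (intro ext)
  fix p u v :: "(real^3) \<times> real"
  have der: "((\<lambda>q. exp_form (heis_form i) q v) has_derivative
      (\<lambda>w. exp (snd p) * (snd w * heis_form i (fst p) (fst v) + heis_form_deriv i (fst p) (fst v) (fst w)))) (at p)"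
    for v :: "(real^3) \<times> real"
    unfolding exp_form_def
    by (auto intro!: derivative_eq_intros
        has_derivative_compose[OF has_derivative_fst[OF has_derivative_ident] heis_form_has_derivative]
        simp: fun_eq_iff algebra_simps)
  have ext: "ext_deriv1 (exp_form (heis_form i)) p u v = exp (snd p) *
      ((snd u * heis_form i (fst p) (fst v) + heis_form_deriv i (fst p) (fst v) (fst u)) -
       (snd v * heis_form i (fst p) (fst u) + heis_form_deriv i (fst p) (fst u) (fst v)))"
    unfolding ext_deriv1_def by (simp add: frechet_derivative_eq[OF der] right_diff_distrib)
  have J: "cof1 p u * cof1 p (heis_J i p v) + cof2 p u * cof2 p (heis_J i p v) +
      cof3 p u * cof3 p (heis_J i p v) + cof4 p u * cof4 p (heis_J i p v) =
      - ((snd u * heis_form i (fst p) (fst v) + heis_form_deriv i (fst p) (fst v) (fst u)) -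
       (snd v * heis_form i (fst p) (fst u) + heis_form_deriv i (fst p) (fst u) (fst v)))"
    \<comment> \<open>The coframe is evaluated on the frame first; only then are its members
      unfolded, leaving polynomial identities.\<close>
    using exhaust_3[of i]
    by (elim disjE)
      (simp_all add: heis_J_def, simp_all add: heis_form_def heis_form_deriv_def Let_def cof_defs field_simps)
  show "fundamental_form heis_metric (heis_J i) p u v = ext_deriv1 (exp_form (heis_form i)) p u v"
    unfolding fundamental_form_def heis_metric_def ext J by (simp only: mult_minus_right minus_minus)
qed

lemma heis_J_smooth: "smooth_on UNIV (\<lambda>p. heis_J i p v)"
  unfolding heis_J_def
  by (cases "i = 1"; cases "i = 2")
    (simp_all, (intro smooth_on_heis_frame smooth_on_cof smooth_on_minus open_UNIV)+)

lemma heis_J_linear: "linear (heis_J i p)"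
  unfolding heis_J_def
  by (cases "i = 1"; cases "i = 2")
    (simp_all, (intro heis_frame_linear cof_linear linear_compose_neg)+)

section \<open>Integrability of the complex structures\<close>

definition heis_shift :: "(real^3) \<times> real \<Rightarrow> real \<Rightarrow> real \<Rightarrow> real \<Rightarrow> (real^3) \<times> real" where
  "heis_shift w a b d =
    ((- fst w $ 1 * d) *\<^sub>R axis 1 1 + (- fst w $ 2 * d) *\<^sub>R axis 2 1 +
     (- 2 * fst w $ 3 * d - (fst w $ 2 * a - fst w $ 1 * b) / 2) *\<^sub>R axis 3 1, 0)"

text \<open>A product rule: \<open>heis_shift\<close> differentiates the frame with frozen
  coefficients. It has no argument for \<open>c\<close>, whose frame vector is constant.\<close>

lemma heis_frame_has_derivative:
  assumes "(a has_derivative a') (at p)" "(b has_derivative b') (at p)"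
    "(c has_derivative c') (at p)" "(d has_derivative d') (at p)"
  shows "((\<lambda>q. heis_frame q (a q) (b q) (c q) (d q)) has_derivative
    (\<lambda>w. heis_frame p (a' w) (b' w) (c' w) (d' w) + heis_shift w (a p) (b p) (d p))) (at p)"
  unfolding heis_frame_def heis_shift_def
  by (auto intro!: derivative_eq_intros assms bounded_linear_imp_has_derivative[OF bounded_linear_fst_nth]
      simp: fun_eq_iff algebra_simps diff_divide_distrib add_divide_distrib)

definition cof1_deriv where "cof1_deriv v w = fst w $ 1 * snd v / 3"
  for v w :: "(real^3) \<times> real"

definition cof2_deriv where "cof2_deriv v w = fst w $ 2 * snd v / 3"
  for v w :: "(real^3) \<times> real"

definition cof3_deriv where
  "cof3_deriv v w = 2 * fst w $ 3 * snd v / 3 + (fst w $ 2 * fst v $ 1 - fst w $ 1 * fst v $ 2) / 2"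
  for v w :: "(real^3) \<times> real"

lemmas cof_deriv_defs = cof1_deriv_def cof2_deriv_def cof3_deriv_def

lemma cof_has_derivative:
  "((\<lambda>q. cof1 q v) has_derivative cof1_deriv v) (at p)"
  "((\<lambda>q. cof2 q v) has_derivative cof2_deriv v) (at p)"
  "((\<lambda>q. cof3 q v) has_derivative cof3_deriv v) (at p)"
  "((\<lambda>q. cof4 q v) has_derivative (\<lambda>w. 0)) (at p)"
  unfolding cof_defs cof_deriv_defs
  by (auto intro!: derivative_eq_intros bounded_linear_imp_has_derivative[OF bounded_linear_fst_nth]
      simp: fun_eq_iff field_simps)

text \<open>The zeros are derivatives of \<open>cof4\<close>, which does not depend on the
  point.\<close>

definition heis_J_deriv :: "3 \<Rightarrow> (real^3) \<times> real \<Rightarrow> (real^3) \<times> real \<Rightarrow> (real^3) \<times> real \<Rightarrow> (real^3) \<times> real" where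
  "heis_J_deriv i p v w =
    (if i = 1 then heis_frame p (cof3_deriv v w) 0 (- cof1_deriv v w) (cof2_deriv v w) +
       heis_shift w (cof3 p v) (- cof4 p v) (cof2 p v)
     else if i = 2 then heis_frame p 0 (cof3_deriv v w) (- cof2_deriv v w) (- cof1_deriv v w) +
       heis_shift w (cof4 p v) (cof3 p v) (- cof1 p v)
     else heis_frame p (- cof2_deriv v w) (cof1_deriv v w) 0 (cof3_deriv v w) +
       heis_shift w (- cof2 p v) (cof1 p v) (cof3 p v))"

lemma heis_J_has_derivative: "((\<lambda>q. heis_J i q v) has_derivative heis_J_deriv i p v) (at p)"
  unfolding heis_J_def heis_J_deriv_def
  by (cases "i = 1"; cases "i = 2")
    (auto intro!: has_derivative_eq_rhs[OF heis_frame_has_derivative] has_derivative_minus cof_has_derivative)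

lemma nijenhuis_heis_J: "nijenhuis (heis_J i) p u v = 0"
proof -
  have cof_shift:
    "cof1 p (heis_shift w a b d) = - fst w $ 1 * d" "cof2 p (heis_shift w a b d) = - fst w $ 2 * d"
    "cof3 p (heis_shift w a b d) = - 2 * fst w $ 3 * d - (fst w $ 2 * a - fst w $ 1 * b) / 2 +
       (fst p $ 1 * fst w $ 2 - fst p $ 2 * fst w $ 1) * d / 2"
    "cof4 p (heis_shift w a b d) = 0" for w a b d
    by (simp_all add: heis_shift_def cof_defs axis_def field_simps)
  have components:
    "fst (heis_frame p a b c d) $ 1 = a - fst p $ 1 * d" "fst (heis_frame p a b c d) $ 2 = b - fst p $ 2 * d"
    "fst (heis_frame p a b c d) $ 3 = c - 2 * fst p $ 3 * d - (fst p $ 2 * a - fst p $ 1 * b) / 2"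
    "snd (heis_frame p a b c d) = 3 * d" for a b c d
    by (simp_all add: heis_frame_def axis_def)
  \<comment> \<open>Writing \<open>u\<close> and \<open>v\<close> in the frame at \<open>p\<close> keeps the polynomial identities in \<open>p\<close> small.\<close>
  have "heis_J_deriv i p v (heis_J i p u) - heis_J_deriv i p u (heis_J i p v) +
      heis_J i p (heis_J_deriv i p u v) - heis_J i p (heis_J_deriv i p v u) = 0"
    if u: "u = heis_frame p a1 a2 a3 a4" and v: "v = heis_frame p b1 b2 b3 b4" for a1 a2 a3 a4 b1 b2 b3 b4
  proof -
    consider "i = 1" | "i = 2" | "i = 3" using exhaust_3[of i] by blast
    then show ?thesis
      by cases (rule cof_eqI[of p];
        simp add: u v heis_J_def heis_J_deriv_def cof_simps cof_shift cof_deriv_defs components field_simps)+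
  qed
  from this[OF heis_frame_cof[symmetric] heis_frame_cof[symmetric]]
  show ?thesis
    \<comment> \<open>For constant fields the last bracket vanishes and the others reduce to the
      four terms above.\<close>
    unfolding nijenhuis_def lie_bracket_def
    by (simp add: frechet_derivative_eq[OF heis_J_has_derivative] linear_neg[OF heis_J_linear])
qed

lemma complex_structure_heis_J: "complex_structure_on UNIV (heis_J i)"
  by (simp add: complex_structure_on_def heis_J_linear heis_J_square heis_J_smooth nijenhuis_heis_J)

lemma exp_form_smooth: "smooth_on UNIV (\<lambda>p. exp_form (heis_form i) p v)"
  unfolding exp_form_def heis_form_def Let_def
  by (cases "i = 1"; cases "i = 2")
    (simp_all, (intro smooth_on_intros smooth_on_fst_nth smooth_on_snd open_UNIV)+)

text \<open>The fundamental forms are closed because they are the exact forms d(e^t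
  \<alpha>_i).\<close>

lemma induced_hyperkaehler_heis: "induced_hyperkaehler UNIV heis_form heis_metric heis_J"
proof -
  have "ext_deriv2 (fundamental_form heis_metric (heis_J i)) p u v z = 0" for i p u v z
    unfolding heis_fundamental_form
    using exp_form_smooth by (intro ext_deriv2_ext_deriv1[of UNIV]) (auto simp: smooth_on_def)
  then show ?thesis
    by (simp add: induced_hyperkaehler_def hyperkaehler_on_def kaehler_on_def riemannian_heis_metric
        complex_structure_heis_J heis_J_isometry heis_J_quaternion heis_fundamental_form)
qed

section \<open>The curvature obstruction at the origin\<close>

lemma heis_metric_not_conformally_flat: "\<not> conformally_flat_on UNIV heis_metric"
proof
  assume "conformally_flat_on UNIV heis_metric"
  then obtain V \<phi> \<psi> f where V: "0 \<in> V" "diffeomorphism V (\<phi> ` V) \<phi> (\<psi> :: (real^3) \<times> real \<Rightarrow> (real^3) \<times> real)"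
    and f: "\<And>q. q \<in> V \<Longrightarrow> f q > 0"
    and conf: "\<And>q u v. q \<in> V \<Longrightarrow> heis_metric q u v = f q * (dirderiv u \<phi> q \<bullet> dirderiv v \<phi> q)"
    unfolding conformally_flat_on_def by (metis UNIV_I)
  have "open V" and smooth: "C_k_on 3 \<phi> V"
    using V(2) unfolding diffeomorphism_def smooth_on_def by blast+
  \<comment> \<open>Constant fields that form the dual frame at the origin. The 3 compensates the
    factor in \<open>cof4\<close>.\<close>
  define X1 X2 X3 X4 :: "(real^3) \<times> real"
    where "X1 = (axis 1 1, 0)" and "X2 = (axis 2 1, 0)" and "X3 = (axis 3 1, 0)" and "X4 = (0, 3)"
  note X_defs = X1_def X2_def X3_def X4_def
  define h where "h u v q = cof1 q u * cof1 q v + cof2 q u * cof2 q v + cof3 q u * cof3 q v + cof4 q u * cof4 q v"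
    for u v q
  have metric: "heis_metric q u v = exp (snd q) * h u v q" for q u v
    by (simp add: heis_metric_def h_def)
  \<comment> \<open>This is \<open>exp (snd q) / f q\<close>. Expressed as a Gram entry, at a field
    where \<open>h\<close> is 1, it inherits its differentiability from \<phi>.\<close>
  define s where "s q = dirderiv X3 \<phi> q \<bullet> dirderiv X3 \<phi> q" for q
  have scale: "exp (snd q) = f q * s q" if "q \<in> V" for q
  proof -
    have "h X3 X3 q = 1"
      by (simp add: h_def X_defs cof_defs axis_def)
    then show ?thesis
      using conf[OF that, of X3 X3] by (simp add: metric s_def)
  qed
  have gram: "dirderiv u \<phi> q \<bullet> dirderiv v \<phi> q = s q * h u v q" if "q \<in> V" for q u v
  proof -
    have "f q * (dirderiv u \<phi> q \<bullet> dirderiv v \<phi> q) = f q * (s q * h u v q)"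
      using conf[OF that, of u v] scale[OF that] by (simp only: metric mult.assoc)
    then show ?thesis using f[OF that] by (metis less_irrefl mult_cancel_left)
  qed
  have C2: "C_k_on 2 \<phi> V" "C_k_on 2 (dirderiv v \<phi>) V" for v
    using smooth C_k_on_SucD[of 2 \<phi> V] C_k_on_dirderiv[of 2 \<phi> V] by simp_all
  have C2_s: "C_k_on 2 s V"
    unfolding s_def by (intro bounded_bilinear.C_k_on_prod[OF bounded_bilinear_inner] \<open>open V\<close> C2)
  have C2_h: "C_k_on 2 (h u v) V" for u v
  proof -
    have "smooth_on UNIV (h u v)"
      unfolding h_def by (intro smooth_on_intros smooth_on_cof open_UNIV)
    then show ?thesis using C_k_on_subset[of 2 "h u v" UNIV V] by (simp add: smooth_on_def)
  qed
  have C2_gram: "C_k_on 2 (\<lambda>q. dirderiv u \<phi> q \<bullet> dirderiv v \<phi> q) V" for u v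
    by (intro bounded_bilinear.C_k_on_prod[OF bounded_bilinear_inner] \<open>open V\<close> C2)
  \<comment> \<open>Reading the product as an inner product of reals makes the product rules for
    inner products applicable.\<close>
  have gram': "dirderiv u \<phi> q \<bullet> dirderiv v \<phi> q = s q \<bullet> h u v q" if "q \<in> V" for q u v
    using gram[OF that] by simp
  have gram_deriv: "dirderiv w (\<lambda>q. dirderiv u \<phi> q \<bullet> dirderiv v \<phi> q) 0 =
      s 0 * dirderiv w (h u v) 0 + dirderiv w s 0 * h u v 0" for u v w
  proof -
    have "dirderiv w (\<lambda>q. dirderiv u \<phi> q \<bullet> dirderiv v \<phi> q) 0 = dirderiv w (\<lambda>q. s q \<bullet> h u v q) 0"
      using gram' C_k_on_imp_differentiable[OF C2_gram] V(1) by (intro dirderiv_cong[OF \<open>open V\<close>]) simp_all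
    also have "\<dots> = s 0 \<bullet> dirderiv w (h u v) 0 + dirderiv w s 0 \<bullet> h u v 0"
      using V(1) C_k_on_imp_differentiable[OF C2_s] C_k_on_imp_differentiable[OF C2_h]
      by (intro dirderiv_inner) simp_all
    finally show ?thesis by simp
  qed
  have gram_deriv2: "dirderiv w (dirderiv w' (\<lambda>q. dirderiv u \<phi> q \<bullet> dirderiv v \<phi> q)) 0 =
      s 0 * dirderiv w (dirderiv w' (h u v)) 0 + dirderiv w s 0 * dirderiv w' (h u v) 0 +
      dirderiv w' s 0 * dirderiv w (h u v) 0 + dirderiv w (dirderiv w' s) 0 * h u v 0" for u v w w'
    using dirderiv_dirderiv_cong[OF \<open>open V\<close> V(1) C2_gram gram']
      dirderiv_dirderiv_inner[OF \<open>open V\<close> V(1) C2_s C2_h] by simp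
  have h_deriv: "dirderiv w (h u v) q =
      cof1 q u * cof1_deriv v w + cof1_deriv u w * cof1 q v +
      cof2 q u * cof2_deriv v w + cof2_deriv u w * cof2 q v +
      cof3 q u * cof3_deriv v w + cof3_deriv u w * cof3 q v" for u v w q
    unfolding h_def
    by (rule fun_cong[OF frechet_derivative_eq])
      (auto intro!: derivative_eq_intros cof_has_derivative simp: fun_eq_iff algebra_simps)
  have h_deriv2: "dirderiv w' (dirderiv w (h u v)) q =
      cof1_deriv u w' * cof1_deriv v w + cof1_deriv u w * cof1_deriv v w' +
      cof2_deriv u w' * cof2_deriv v w + cof2_deriv u w * cof2_deriv v w' +
      cof3_deriv u w' * cof3_deriv v w + cof3_deriv u w * cof3_deriv v w'" for u v w w' q
    unfolding h_deriv
    by (rule fun_cong[OF frechet_derivative_eq])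
      (auto intro!: derivative_eq_intros cof_has_derivative simp: fun_eq_iff algebra_simps)
  note eval = h_deriv h_def cof_defs cof_deriv_defs X_defs
  let ?P = "\<lambda>u. dirderiv u \<phi> 0" and ?Q = "\<lambda>u v. dirderiv u (dirderiv v \<phi>) 0"
  define I where "I = {X1, X2, X3, X4}"
  have neq: "X1 \<noteq> X2" "X1 \<noteq> X3" "X1 \<noteq> X4" "X2 \<noteq> X3" "X2 \<noteq> X4" "X3 \<noteq> X4"
    by (simp_all add: X_defs axis_eq_axis)
  have "s 0 > 0"
    using scale[OF V(1)] f[OF V(1)] by (metis exp_gt_zero zero_less_mult_pos)
  have ortho: "?P u \<bullet> ?P v = (if u = v then s 0 else 0)" if "u \<in> I" "v \<in> I" for u v
    using that neq unfolding gram[OF V(1)] I_def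
    by (auto simp: h_def cof_defs) (simp_all add: X_defs axis_def)
  \<comment> \<open>Four orthogonal vectors of equal length form a basis of the four-dimensional
    target.\<close>
  have parseval: "s 0 * (x \<bullet> y) = (x \<bullet> ?P X1) * (y \<bullet> ?P X1) + (x \<bullet> ?P X2) * (y \<bullet> ?P X2) +
      (x \<bullet> ?P X3) * (y \<bullet> ?P X3) + (x \<bullet> ?P X4) * (y \<bullet> ?P X4)" for x y
  proof -
    have "s 0 * (x \<bullet> y) = (\<Sum>i\<in>I. (x \<bullet> ?P i) * (y \<bullet> ?P i))"
      using neq \<open>s 0 > 0\<close> ortho by (intro inner_orthogonal_family) (simp_all add: I_def)
    then show ?thesis using neq by (simp add: I_def)
  qed
  note koszul = koszul_identity[OF \<open>open V\<close> V(1) C2(1), unfolded gram_deriv]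
  \<comment> \<open>Only the components needed for the two Parseval sums are computed: each omitted
    one is multiplied by a vanishing one.\<close>
  have Q12: "?Q X1 X2 \<bullet> ?P X3 = 0" "?Q X1 X2 \<bullet> ?P X4 = 0"
    using koszul[where a = X1 and b = X2 and c = X3] koszul[where a = X1 and b = X2 and c = X4]
    by (simp_all add: eval axis_def)
  have Q34: "?Q X3 X4 \<bullet> ?P X1 = 0" "?Q X3 X4 \<bullet> ?P X2 = 0"
    using koszul[where a = X3 and b = X4 and c = X1] koszul[where a = X3 and b = X4 and c = X2]
    by (simp_all add: eval axis_def)
  have Q13: "?Q X1 X3 \<bullet> ?P X2 = - s 0 / 2" "?Q X1 X3 \<bullet> ?P X4 = 0"
    using koszul[where a = X1 and b = X3 and c = X2] koszul[where a = X1 and b = X3 and c = X4]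
    by (simp_all add: eval axis_def)
  have Q24: "?Q X2 X4 \<bullet> ?P X1 = 0" "?Q X2 X4 \<bullet> ?P X2 = dirderiv X4 s 0 / 2" "?Q X2 X4 \<bullet> ?P X3 = 0"
    using koszul[where a = X2 and b = X4 and c = X1] koszul[where a = X2 and b = X4 and c = X2]
      koszul[where a = X2 and b = X4 and c = X3]
    by (simp_all add: eval axis_def)
  have "s 0 * (?Q X1 X2 \<bullet> ?Q X3 X4) = 0"
    unfolding parseval by (simp add: Q12 Q34)
  then have Q12_34: "?Q X1 X2 \<bullet> ?Q X3 X4 = 0"
    using \<open>s 0 > 0\<close> by simp
  \<comment> \<open>Only the term along \<open>?P X2\<close> survives.\<close>
  have "s 0 * (?Q X1 X3 \<bullet> ?Q X2 X4) = s 0 * (- dirderiv X4 s 0 / 4)"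
    unfolding parseval by (simp add: Q13 Q24)
  then have Q13_24: "?Q X1 X3 \<bullet> ?Q X2 X4 = - dirderiv X4 s 0 / 4"
    using \<open>s 0 > 0\<close> by (simp only: mult_cancel_left) simp
  \<comment> \<open>The \<open>- s 0\<close> stems from the second derivative -1 of
    \<open>h X2 X4\<close> along \<open>X1\<close> and \<open>X3\<close>. The derivative of
    \<open>s\<close> contributes equally to both sides and cancels, leaving
    \<open>s 0 = 0\<close>.\<close>
  have "2 * (?Q X1 X2 \<bullet> ?Q X3 X4 - ?Q X1 X3 \<bullet> ?Q X2 X4) = - s 0 + dirderiv X4 s 0 / 2"
    unfolding gauss_identity[OF \<open>open V\<close> V(1) smooth] gram_deriv2 h_deriv2
    by (simp add: eval axis_def)
  then show False
    using \<open>s 0 > 0\<close> by (simp add: Q12_34 Q13_24)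
qed

theorem theorem14:
  shows "\<exists>(U :: (real^3) set) (\<alpha> :: 3 \<Rightarrow> (real^3) form1) g J.
    open U \<and> connected U \<and> U \<noteq> {} \<and>
    contact_sphere_on U \<alpha> \<and> naturally_ordered_on U \<alpha> \<and> taut_on U \<alpha> \<and>
    induced_hyperkaehler U \<alpha> g J \<and>
    \<not> conformally_flat_on (U \<times> UNIV) g"
  using contact_sphere_heis naturally_ordered_heis taut_heis induced_hyperkaehler_heis
    heis_metric_not_conformally_flat
  by (intro exI[of _ UNIV] exI[of _ heis_form] exI[of _ heis_metric] exI[of _ heis_J]) (simp add: connected_UNIV)

end
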